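(* Let $\mathbb{H}_1,\mathbb{H}_2$ be real Hilbert spaces. Let $T\in S_{\mathbb{L}(\mathbb{H}_1,\mathbb{H}_2)}$. Let $M_T\neq\emptyset$ and $M_T=S_{H_0}$, where $H_0$ is a subspace of $\mathbb{H}_1$. Suppose $\sup\{\|Tz\|:z\in C\}<1$ holds for each closed subset $C$ of $S_{\mathbb{H}_1}$ with $d(M_T,C)>0$. Then there exists $\epsilon_0>0$ such that for any $0<\epsilon<\epsilon_0$, if $A_\epsilon$ is a uniform $\epsilon$-BPB approximation of $T$, then the following conditions hold: (i) $H_0^\perp\cap H=\{0\}$ and $H^\perp\cap H_0=\{0\}$, where $M_{A_\epsilon}=S_H$ for some subspace $H$ of $\mathbb{H}_1$; (ii) for any $\epsilon_1,\epsilon_2>0$ with $\epsilon_1^2+\epsilon_2^2>2\epsilon^2$, either $\|(T-A_\epsilon)|_{H_0}\|<\epsilon_1$ or $\|(T-A_\epsilon)|_{H_0^\perp}\|<\epsilon_2$; (iii) there exists $\delta=\delta(\epsilon)>0$ such that $M_T(\delta)\subseteq\bigcup_{x\in M_{A_\epsilon}}B(x,\epsilon)$.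
   Context: $\mathbb{L}(\mathbb{H}_1,\mathbb{H}_2)$ is the space of bounded linear operators with the operator norm; $S_Z$ is the unit sphere of a normed space $Z$; $B(x,r)$ is the open ball with center $x$ and radius $r$; $d(M,C)=\inf\{\|x-y\|:x\in M,y\in C\}$. For an operator $A$ and $\delta>0$, $M_A=\{x\in S_{\mathbb{H}_1}:\|Ax\|=\|A\|\}$ and $M_A(\delta)=\{x\in S_{\mathbb{H}_1}:\|Ax\|>\|A\|-\delta\}$. It is a known fact that for an operator between Hilbert spaces $M_A$ is either empty or the unit sphere of a subspace of the domain. For $T\in S_{\mathbb{L}(\mathbb{H}_1,\mathbb{H}_2)}$ and $\epsilon>0$, an operator $A\in S_{\mathbb{L}(\mathbb{H}_1,\mathbb{H}_2)}$ is a uniform $\epsilon$-BPB approximation of $T$ if $\|T-A\|<\epsilon$ and there exists $\delta(\epsilon)>0$ such that for each $x_0\in S_{\mathbb{H}_1}$ with $\|Tx_0\|>1-\delta(\epsilon)$ there exists $u_0\in M_A$ with $\|u_0-x_0\|<\epsilon$. *)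

theory Defs
  imports "HOL-Analysis.Analysis"
begin

definition unit_sphere :: "'a::real_normed_vector set \<Rightarrow> 'a set" where
  "unit_sphere Z = sphere 0 1 \<inter> Z"

definition norm_attainment_set ::
    "('a::real_normed_vector \<Rightarrow>\<^sub>L 'b::real_normed_vector) \<Rightarrow> 'a set" where
  "norm_attainment_set A = {x \<in> unit_sphere UNIV. norm (A x) = norm A}"

definition approx_norm_attainment_set ::
    "('a::real_normed_vector \<Rightarrow>\<^sub>L 'b::real_normed_vector) \<Rightarrow> real \<Rightarrow> 'a set" where
  "approx_norm_attainment_set A \<delta> = {x \<in> unit_sphere UNIV. norm (A x) > norm A - \<delta>}"

text \<open>
  The operator norm of the restriction of \<open>F\<close> to a subspace \<open>Z\<close>, in the same form as
  \<^const>\<open>onorm\<close>.  For \<open>Z = {0}\<close> the value is \<open>0\<close>.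
\<close>
definition restriction_norm ::
    "('a::real_normed_vector \<Rightarrow>\<^sub>L 'b::real_normed_vector) \<Rightarrow> 'a set \<Rightarrow> real" where
  "restriction_norm F Z = (SUP x\<in>Z. norm (F x) / norm x)"

lemma restriction_norm_UNIV: "restriction_norm F UNIV = norm F"
  by (simp add: restriction_norm_def norm_blinfun.rep_eq onorm_def)

text \<open>Intended for \<open>norm T = 1\<close> and \<open>\<epsilon> > 0\<close>.\<close>
definition uniform_BPB_approximation ::
    "real \<Rightarrow> ('a::real_normed_vector \<Rightarrow>\<^sub>L 'b::real_normed_vector) \<Rightarrow> ('a \<Rightarrow>\<^sub>L 'b) \<Rightarrow> bool" where
  "uniform_BPB_approximation \<epsilon> T A \<longleftrightarrow>
     norm A = 1 \<and> norm (T - A) < \<epsilon> \<and>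
     (\<exists>\<delta>>0. \<forall>x\<^sub>0 \<in> unit_sphere UNIV. norm (T x\<^sub>0) > 1 - \<delta> \<longrightarrow>
        (\<exists>u\<^sub>0 \<in> norm_attainment_set A. norm (u\<^sub>0 - x\<^sub>0) < \<epsilon>))"

text \<open>
  \<^const>\<open>setdist\<close> is \<open>0\<close> if one of the sets is empty, so the empty \<open>C\<close> is excluded here.
  With the conventions \<open>inf {} = \<infinity>\<close> and \<open>sup {} = -\<infinity>\<close> the empty \<open>C\<close> satisfies the
  condition trivially, so nothing is lost.
\<close>
definition norm_gap_condition ::
    "('a::real_normed_vector \<Rightarrow>\<^sub>L 'b::real_normed_vector) \<Rightarrow> bool" where
  "norm_gap_condition T \<longleftrightarrow>
     (\<forall>C. closed C \<and> C \<subseteq> unit_sphere UNIV \<and> setdist (norm_attainment_set T) C > 0 \<longrightarrow>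
        (SUP z\<in>C. norm (T z)) < 1)"

end

(* Every unit vector of the orthogonal complement of H_0 has distance sqrt 2 from M_T, so the gap
   hypothesis bounds T there by some q < 1; hence for eps < min 1 (1 - q) an eps-perturbation of T
   cannot attain norm 1 on that complement.  Conversely, a unit vector of H_0 orthogonal to H would
   have distance sqrt 2 from each point of M_A.  For (ii), both restriction norms are at most
   the norm of T - A, which is less than eps, while one of eps_1, eps_2 exceeds eps. *)
theory Submission
  imports Defs
begin

lemma parallelogram_identity:
  fixes x y :: "'a::real_inner"
  shows "(norm (x + y))\<^sup>2 + (norm (x - y))\<^sup>2 = 2 * (norm x)\<^sup>2 + 2 * (norm y)\<^sup>2"
  by (simp add: power2_norm_eq_inner inner_add inner_diff inner_commute algebra_simps)

text \<open>By the parallelogram law in both spaces, the bounds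
  \<open>norm (A z) \<le> norm A * norm z\<close> for z = x + y and z = x - y become an equality
  once squared and added, so neither can be strict. The homogeneous form of the condition, without
  \<open>norm x = 1\<close>, is what makes the set closed under scaling.\<close>

lemma subspace_norm_attained:
  fixes A :: "'a::real_inner \<Rightarrow>\<^sub>L 'b::real_inner"
  shows "subspace {x. norm (A x) = norm A * norm x}"
proof (rule subspaceI)
  fix x y assume "x \<in> {x. norm (A x) = norm A * norm x}" "y \<in> {x. norm (A x) = norm A * norm x}"
  then have xy: "norm (A x) = norm A * norm x" "norm (A y) = norm A * norm y"
    by auto
  have "(norm (A (x + y)))\<^sup>2 + (norm (A (x - y)))\<^sup>2 = 2 * (norm (A x))\<^sup>2 + 2 * (norm (A y))\<^sup>2"
    by (simp add: blinfun.add_right blinfun.diff_right parallelogram_identity)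
  also have "\<dots> = (norm A)\<^sup>2 * ((norm (x + y))\<^sup>2 + (norm (x - y))\<^sup>2)"
    unfolding parallelogram_identity by (simp add: xy power_mult_distrib algebra_simps)
  finally have sum_eq: "(norm (A (x + y)))\<^sup>2 + (norm (A (x - y)))\<^sup>2
      = (norm A * norm (x + y))\<^sup>2 + (norm A * norm (x - y))\<^sup>2"
    by (simp add: power_mult_distrib algebra_simps)
  have "(norm (A (x - y)))\<^sup>2 \<le> (norm A * norm (x - y))\<^sup>2"
    by (intro power_mono norm_blinfun norm_ge_zero)
  then have "(norm A * norm (x + y))\<^sup>2 \<le> (norm (A (x + y)))\<^sup>2"
    using sum_eq by linarith
  then have "norm A * norm (x + y) \<le> norm (A (x + y))"
    by (rule power2_le_imp_le) simp
  then show "x + y \<in> {x. norm (A x) = norm A * norm x}"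
    using norm_blinfun[of A "x + y"] by simp
qed (auto simp: blinfun.scaleR_right)

lemma norm_attainment_set_eq_unit_sphere:
  "norm_attainment_set A = unit_sphere {x. norm (A x) = norm A * norm x}"
  by (auto simp: norm_attainment_set_def unit_sphere_def)

lemma restriction_norm_le:
  assumes "0 \<in> Z"
  shows "restriction_norm F Z \<le> norm F"
  unfolding restriction_norm_def
\<comment> \<open>The supremum rule asks for a nonempty index set, which 0 witnesses; the quotient
  at 0 is 0 because division by zero gives 0.\<close>
proof (rule cSUP_least)
  show "norm (F x) / norm x \<le> norm F" for x
    using norm_blinfun[of F x] by (cases "x = 0") (auto simp: divide_simps)
qed (use assms in auto)

text \<open>The gap hypothesis speaks of closed sets only; this makes it applicable to the unit
  sphere of a complement.\<close>

lemma closed_orthogonal_complement: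
  fixes S :: "'a::real_inner set"
  shows "closed (orthogonal_comp S)"
proof -
  have "orthogonal_comp S = (\<Inter>y\<in>S. {x. y \<bullet> x = 0})"
    by (auto simp: orthogonal_comp_def orthogonal_def)
  then show ?thesis
    by (auto intro!: closed_INT closed_Collect_eq continuous_intros)
qed

text \<open>Pythagoras. For two unit vectors the distance is sqrt 2, but the cruder bound 1
  suffices, since \<epsilon> will be below 1.\<close>

lemma one_le_dist_orthogonal:
  fixes x y :: "'a::real_inner"
  assumes "norm x = 1" and "x \<bullet> y = 0"
  shows "1 \<le> dist x y"
proof -
  have "(dist x y)\<^sup>2 = (norm x)\<^sup>2 + (norm y)\<^sup>2"
    using assms(2) by (simp add: dist_norm power2_norm_eq_inner inner_diff inner_commute)
  then have "1\<^sup>2 \<le> (dist x y)\<^sup>2"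
    using assms(1) by simp
  then show ?thesis
    by (rule power2_le_imp_le) simp
qed

text \<open>A nonzero common vector could be normalized inside both subspaces, so condition (i) has
  to be refuted on unit vectors only.\<close>

lemma subspace_Int_eq_zeroI:
  assumes "subspace U" and "subspace V" and "\<And>x. x \<in> U \<Longrightarrow> x \<in> V \<Longrightarrow> norm x \<noteq> 1"
  shows "U \<inter> V = {0}"
proof -
  have "x = 0" if "x \<in> U" "x \<in> V" for x
  proof (rule ccontr)
    assume "x \<noteq> 0"
    then have "norm (x /\<^sub>R norm x) = 1"
      by simp
    then show False
      using assms that by (meson subspace_scale)
  qed
  then show ?thesis
    using assms(1,2) by (auto simp: subspace_0)
qed

lemma norm_gap_orthogonal_complement:
  fixes T :: "'a::real_inner \<Rightarrow>\<^sub>L 'b::real_inner"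
  assumes "norm_attainment_set T \<noteq> {}" and "norm_attainment_set T = unit_sphere H"
    and "norm_gap_condition T"
  obtains q where "q < 1" and "\<And>x. x \<in> unit_sphere (orthogonal_comp H) \<Longrightarrow> norm (T x) \<le> q"
proof (cases "unit_sphere (orthogonal_comp H) = {}")
  case True
  \<comment> \<open>\<open>setdist\<close> to the empty set is 0, so the gap hypothesis says nothing
    here; the bound holds vacuously for any q below 1.\<close>
  then show ?thesis
    by (intro that[of 0]) auto
next
  case False
  let ?C = "unit_sphere (orthogonal_comp H)"
  have "1 \<le> setdist (norm_attainment_set T) ?C"
  proof (rule le_setdistI)
    fix x y assume "x \<in> norm_attainment_set T" "y \<in> ?C"
    then show "1 \<le> dist x y"
      using assms(2)
      by (intro one_le_dist_orthogonal)
        (auto simp: unit_sphere_def orthogonal_comp_def orthogonal_def)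
  qed (use assms(1) False in auto)
  moreover have "closed ?C"
    unfolding unit_sphere_def sphere_def
    by (intro closed_Int closed_Collect_eq closed_orthogonal_complement continuous_intros)
  moreover have "?C \<subseteq> unit_sphere UNIV"
    by (auto simp: unit_sphere_def)
  ultimately have "(SUP z\<in>?C. norm (T z)) < 1"
    using assms(3) by (auto simp: norm_gap_condition_def)
  \<comment> \<open>A real \<open>SUP\<close> dominates the values only if these are bounded
    above.\<close>
  moreover have "bdd_above ((\<lambda>z. norm (T z)) ` ?C)"
  proof (rule bdd_aboveI2)
    show "norm (T z) \<le> norm T" if "z \<in> ?C" for z
      using norm_blinfun[of T z] that by (simp add: unit_sphere_def)
  qed
  ultimately show ?thesis
    by (intro that[of "SUP z\<in>?C. norm (T z)"] cSUP_upper)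
qed

theorem theorem5p6:
  fixes T :: "'a::{real_inner, complete_space} \<Rightarrow>\<^sub>L 'b::{real_inner, complete_space}"
    and H\<^sub>0 :: "'a set"
  assumes "norm T = 1"
    and "norm_attainment_set T \<noteq> {}"
    and "subspace H\<^sub>0"
    and "norm_attainment_set T = unit_sphere H\<^sub>0"
    and "norm_gap_condition T"
  shows "\<exists>\<epsilon>\<^sub>0>0. \<forall>\<epsilon>. 0 < \<epsilon> \<and> \<epsilon> < \<epsilon>\<^sub>0 \<longrightarrow>
    (\<forall>A. uniform_BPB_approximation \<epsilon> T A \<longrightarrow>
      (\<exists>H. subspace H \<and> norm_attainment_set A = unit_sphere H \<and>
           orthogonal_comp H\<^sub>0 \<inter> H = {0} \<and> orthogonal_comp H \<inter> H\<^sub>0 = {0}) \<and>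
      (\<forall>\<epsilon>\<^sub>1 \<epsilon>\<^sub>2. \<epsilon>\<^sub>1 > 0 \<and> \<epsilon>\<^sub>2 > 0 \<and> \<epsilon>\<^sub>1\<^sup>2 + \<epsilon>\<^sub>2\<^sup>2 > 2 * \<epsilon>\<^sup>2 \<longrightarrow>
           restriction_norm (T - A) H\<^sub>0 < \<epsilon>\<^sub>1 \<or>
           restriction_norm (T - A) (orthogonal_comp H\<^sub>0) < \<epsilon>\<^sub>2) \<and>
      (\<exists>\<delta>>0. approx_norm_attainment_set T \<delta> \<subseteq> (\<Union>x\<in>norm_attainment_set A. ball x \<epsilon>)))"
proof -
  obtain q where q: "q < 1" "\<And>x. x \<in> unit_sphere (orthogonal_comp H\<^sub>0) \<Longrightarrow> norm (T x) \<le> q"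
    using norm_gap_orthogonal_complement[OF assms(2,4,5)] by metis
  show ?thesis
  \<comment> \<open>The bound 1 - q excludes unit vectors of H that are orthogonal to
    \<open>H\<^sub>0\<close>; the bound 1 excludes unit vectors of \<open>H\<^sub>0\<close> that are
    orthogonal to H.\<close>
  proof (rule exI[of _ "min 1 (1 - q)"], intro conjI allI impI)
    show "0 < min 1 (1 - q)"
      using q(1) by simp
  next
    fix \<epsilon> A
    assume \<epsilon>: "0 < \<epsilon> \<and> \<epsilon> < min 1 (1 - q)" and "uniform_BPB_approximation \<epsilon> T A"
    then obtain \<delta> where A: "norm A = 1" "norm (T - A) < \<epsilon>" and "\<delta> > 0"
      and \<delta>: "\<And>x. norm x = 1 \<Longrightarrow> norm (T x) > 1 - \<delta>
        \<Longrightarrow> \<exists>u\<in>norm_attainment_set A. norm (u - x) < \<epsilon>"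
      by (auto simp: uniform_BPB_approximation_def unit_sphere_def)
    define H where "H = {x. norm (A x) = norm A * norm x}"
    have H: "subspace H" "norm_attainment_set A = unit_sphere H"
      by (simp_all add: H_def subspace_norm_attained norm_attainment_set_eq_unit_sphere)
    have "orthogonal_comp H\<^sub>0 \<inter> H = {0}"
    proof (rule subspace_Int_eq_zeroI)
      fix x assume x: "x \<in> orthogonal_comp H\<^sub>0" "x \<in> H"
      show "norm x \<noteq> 1"
      proof
        assume "norm x = 1"
        then have "norm (T x) \<le> q" and "norm (A x) = 1"
          using x q(2) A(1) by (auto simp: unit_sphere_def H_def)
        moreover have "norm (T x - A x) < \<epsilon>"
          using norm_blinfun[of "T - A" x] A(2) \<open>norm x = 1\<close> by (simp add: blinfun.diff_left)
        \<comment> \<open>The norms of A x and T x differ by at least 1 - q, which exceeds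
          \<epsilon>.\<close>
        ultimately show False
          using norm_triangle_ineq2[of "A x" "T x"] \<epsilon> by (simp add: norm_minus_commute)
      qed
    qed (simp_all add: H subspace_orthogonal_comp)
    moreover have "orthogonal_comp H \<inter> H\<^sub>0 = {0}"
    proof (rule subspace_Int_eq_zeroI)
      fix x assume x: "x \<in> orthogonal_comp H" "x \<in> H\<^sub>0"
      show "norm x \<noteq> 1"
      proof
        assume "norm x = 1"
        then have "x \<in> norm_attainment_set T"
          using x(2) assms(4) by (simp add: unit_sphere_def)
        then have "norm (T x) = 1"
          using assms(1) by (simp add: norm_attainment_set_def)
        \<comment> \<open>As x attains the norm of T, it passes the threshold 1 - \<delta> for every
          positive \<delta>.\<close>
        then obtain u where u: "u \<in> unit_sphere H" "norm (u - x) < \<epsilon>"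
          using \<delta>[of x] \<open>norm x = 1\<close> \<open>\<delta> > 0\<close> H(2) by auto
        then have "1 \<le> dist u x"
          using x(1)
          by (intro one_le_dist_orthogonal)
            (auto simp: unit_sphere_def orthogonal_comp_def orthogonal_def)
        then show False
          using u(2) \<epsilon> by (simp add: dist_norm)
      qed
    qed (simp_all add: assms(3) subspace_orthogonal_comp)
    ultimately show "\<exists>H. subspace H \<and> norm_attainment_set A = unit_sphere H \<and>
        orthogonal_comp H\<^sub>0 \<inter> H = {0} \<and> orthogonal_comp H \<inter> H\<^sub>0 = {0}"
      using H by blast
  next
    fix \<epsilon> \<epsilon>\<^sub>1 \<epsilon>\<^sub>2 :: real
    fix A
    assume \<epsilon>: "0 < \<epsilon> \<and> \<epsilon> < min 1 (1 - q)" and "uniform_BPB_approximation \<epsilon> T A"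
      and \<epsilon>12: "0 < \<epsilon>\<^sub>1 \<and> 0 < \<epsilon>\<^sub>2 \<and> 2 * \<epsilon>\<^sup>2 < \<epsilon>\<^sub>1\<^sup>2 + \<epsilon>\<^sub>2\<^sup>2"
    then have "norm (T - A) < \<epsilon>"
      by (simp add: uniform_BPB_approximation_def)
    moreover have "\<epsilon> < \<epsilon>\<^sub>1 \<or> \<epsilon> < \<epsilon>\<^sub>2"
    proof (rule ccontr)
      assume "\<not> ?thesis"
      then have "\<epsilon>\<^sub>1\<^sup>2 \<le> \<epsilon>\<^sup>2" "\<epsilon>\<^sub>2\<^sup>2 \<le> \<epsilon>\<^sup>2"
        using \<epsilon>12 by (auto intro: power_mono)
      then show False
        using \<epsilon>12 by linarith
    qed
    moreover have "restriction_norm (T - A) H\<^sub>0 \<le> norm (T - A)"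
      and "restriction_norm (T - A) (orthogonal_comp H\<^sub>0) \<le> norm (T - A)"
      by (simp_all add: restriction_norm_le subspace_0 assms(3) subspace_orthogonal_comp)
    ultimately show "restriction_norm (T - A) H\<^sub>0 < \<epsilon>\<^sub>1 \<or>
        restriction_norm (T - A) (orthogonal_comp H\<^sub>0) < \<epsilon>\<^sub>2"
      by linarith
  next
    fix \<epsilon> A
    assume "uniform_BPB_approximation \<epsilon> T A"
    then obtain \<delta> where "\<delta> > 0" and "\<forall>x\<in>unit_sphere UNIV. norm (T x) > 1 - \<delta>
        \<longrightarrow> (\<exists>u\<in>norm_attainment_set A. norm (u - x) < \<epsilon>)"
      by (auto simp: uniform_BPB_approximation_def)
    \<comment> \<open>With \<open>norm T = 1\<close> the two thresholds coincide, so the \<delta> of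
      the approximation itself serves for (iii).\<close>
    then show "\<exists>\<delta>>0. approx_norm_attainment_set T \<delta> \<subseteq> (\<Union>x\<in>norm_attainment_set A. ball x \<epsilon>)"
      using assms(1)
      by (intro exI[of _ \<delta>]) (auto simp: approx_norm_attainment_set_def dist_norm)
  qed
qed

end
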